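(* Let $X$ be an infinite dimensional Banach space and let $P$ be a reflexive and generating cone of $X$ with a bounded base. Then $P$ is not a lattice cone, i.e. $X$ ordered by $P$ is not a vector lattice.
   Context: All spaces are real. $B_X$ is the closed unit ball of $X$. A cone of $X$ is a nonempty convex set $P\subseteq X$ with $\lambda P\subseteq P$ for every real $\lambda\ge 0$; it induces the order $x\le y\iff y-x\in P$. $P$ is reflexive if $P\cap B_X$ is weakly compact, and generating if $P-P=X$. A base for $P$ is a convex subset $B$ of $P$ such that for each $x\in P$, $x\neq 0$, there is a unique real number $f(x)>0$ with $x/f(x)\in B$ (equivalently, $B=\{x\in P: f(x)=1\}$ for a, not necessarily continuous, linear functional $f$ of $X$ with $f(x)>0$ for all $x\in P\setminus\{0\}$). *)

theory Defs
  imports "HOL-Analysis.Analysis"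
begin

definition infinite_dimensional :: "'a::real_vector itself \<Rightarrow> bool" where
  "infinite_dimensional _ \<longleftrightarrow> \<not> (\<exists>S :: 'a set. finite S \<and> span S = UNIV)"

text \<open>The coarsest topology making all continuous linear functionals continuous.\<close>

definition weak_topology :: "'a::real_normed_vector topology" where
  "weak_topology =
     topology_generated_by {f -` U | (f :: 'a \<Rightarrow> real) U. bounded_linear f \<and> open U}"

text \<open>Cones are the library's \<^const>\<open>convex_cone\<close>: nonempty, convex, and stable under
  multiplication by nonnegative scalars.  They need be neither pointed nor closed.\<close>

definition reflexive_cone :: "'a::real_normed_vector set \<Rightarrow> bool" where
  "reflexive_cone P \<longleftrightarrow> convex_cone P \<and> compactin weak_topology (P \<inter> cball 0 1)"

definition generating_cone :: "'a::real_vector set \<Rightarrow> bool" where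
  "generating_cone P \<longleftrightarrow> convex_cone P \<and> {x - y | x y. x \<in> P \<and> y \<in> P} = UNIV"

definition cone_base :: "'a::real_vector set \<Rightarrow> 'a set \<Rightarrow> bool" where
  "cone_base P B \<longleftrightarrow> convex B \<and> B \<subseteq> P \<and>
     (\<forall>x\<in>P. x \<noteq> 0 \<longrightarrow> (\<exists>!t::real. t > 0 \<and> x /\<^sub>R t \<in> B))"

definition cone_le :: "'a::real_vector set \<Rightarrow> 'a \<Rightarrow> 'a \<Rightarrow> bool" where
  "cone_le P x y \<longleftrightarrow> y - x \<in> P"

text \<open>A vector lattice is a real vector space with a compatible partial order in which any two
  elements have an infimum and a supremum.  The class predicate \<open>class.lattice\<close> includes
  the partial order axioms, in particular antisymmetry.\<close>

definition vector_lattice_order :: "('a::real_vector \<Rightarrow> 'a \<Rightarrow> bool) \<Rightarrow> bool" where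
  "vector_lattice_order le \<longleftrightarrow>
     (\<forall>x y z. le x y \<longrightarrow> le (x + z) (y + z)) \<and>
     (\<forall>x y. \<forall>c\<ge>0. le x y \<longrightarrow> le (c *\<^sub>R x) (c *\<^sub>R y)) \<and>
     (\<exists>inf sup. class.lattice inf le (\<lambda>x y. le x y \<and> \<not> le y x) sup)"

definition lattice_cone :: "'a::real_vector set \<Rightarrow> bool" where
  "lattice_cone P \<longleftrightarrow> convex_cone P \<and> vector_lattice_order (cone_le P)"

end

theory Submission
  imports Defs
begin

text \<open>
  Suppose that the order were a lattice order.  By weak compactness and the Hahn--Banach theorem the
  cone \<open>P\<close> is closed (\<open>closed_if_weakly_compact_part\<close>).  The bounded base yields a linear functional
  \<open>f\<close> and a constant \<open>M\<close> with \<open>norm x \<le> M * f x\<close> on \<open>P\<close> (\<open>bounded_base_functional\<close>).  A positive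
  linear functional on a Banach space with closed generating cone is continuous
  (\<open>positive_linear_bounded\<close>), so the value of \<open>f\<close> at the absolute value is an equivalent
  norm, additive on \<open>P\<close>; it makes the space an \<open>L\<^sup>1\<close>-space whose positive unit ball is weakly compact.  Infinite-dimensional \<open>L\<^sup>1\<close>-spaces are not
  reflexive because they contain disjoint sequences, which span copies of \<open>\<ell>\<^sup>1\<close>; the proof makes this
  last step concrete without representing the space.

  In infinite dimensions there is a sequence of nonzero, pairwise disjoint positive elements
  (\<open>disjoint_sequence_exists\<close>).  Normalise it to a sequence \<open>x\<close> in \<open>P \<inter> cball 0 1\<close> on which \<open>f\<close> has a
  constant value \<open>c > 0\<close>.  For a set \<open>N\<close> of indices let \<open>\<phi> N y\<close> be the supremum of \<open>f (meet y v)\<close> over all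
  \<open>v\<close> in the cone spanned by the \<open>x n\<close> with \<open>n \<in> N\<close>.  This extends to a positive linear
  functional (\<open>band_functional\<close>), which is continuous by automatic continuity.  As \<open>\<phi> UNIV\<close> is the
  supremum of the \<open>\<phi> {..<n}\<close> on \<open>P\<close>, the weakly open sets \<open>{y. \<phi> UNIV y < c}\<close> and
  \<open>{y. \<phi> {..<n} y > 0}\<close> cover \<open>P\<close>.  But finitely many of them cannot contain all the \<open>x m\<close>: the first
  contains none, and \<open>\<phi> {..<n} (x m) = 0\<close> as soon as \<open>m \<ge> n\<close>.
\<close>

section \<open>Separating functionals and weakly compact cones\<close>

definition sublinear :: "('a::real_vector \<Rightarrow> real) \<Rightarrow> bool" where
  "sublinear p \<longleftrightarrow> (\<forall>x y. p (x + y) \<le> p x + p y) \<and> (\<forall>c>0. \<forall>x. p (c *\<^sub>R x) \<le> c * p x)"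

lemma sublinear_add: "sublinear p \<Longrightarrow> p (x + y) \<le> p x + p y"
  by (simp add: sublinear_def)

lemma sublinear_zero:
  assumes "sublinear p" shows "p 0 = 0"
proof -
  have "p 0 \<le> c * p 0" if "c > 0" for c
    using assms that unfolding sublinear_def by (metis scaleR_zero_right)
  from this[of 2] this[of "1/2"] show ?thesis by simp
qed

lemma sublinear_scale:
  assumes "sublinear p" "c \<ge> 0" shows "p (c *\<^sub>R x) = c * p x"
proof (cases "c = 0")
  case False
  with assms have c: "c > 0" by simp
  have "p x = p (inverse c *\<^sub>R (c *\<^sub>R x))" using c by simp
  also have "\<dots> \<le> inverse c * p (c *\<^sub>R x)"
    using assms c unfolding sublinear_def by (metis positive_imp_inverse_positive)
  finally have "c * p x \<le> p (c *\<^sub>R x)" using c by (simp add: field_simps)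
  with assms c show ?thesis unfolding sublinear_def by (meson antisym)
qed (use assms sublinear_zero in auto)

lemma sublinear_lower:
  assumes "sublinear p" shows "- p (- x) \<le> p x"
  using sublinear_add[OF assms, of x "-x"] sublinear_zero[OF assms] by simp

text \<open>Subtracting as much of the direction \<open>y\<close> as possible from \<open>p\<close>.  The result is again sublinear,
  lies below \<open>p\<close>, and takes the value \<open>- p y\<close> or less at \<open>- y\<close>; a sublinear functional that no
  tilt decreases is therefore additive.\<close>

definition tilt :: "('a::real_vector \<Rightarrow> real) \<Rightarrow> 'a \<Rightarrow> 'a \<Rightarrow> real" where
  "tilt p y x = (INF t\<in>{0..}. p (x + t *\<^sub>R y) - t * p y)"

lemma tilt_le:
  assumes p: "sublinear p" and "t \<ge> 0"
  shows "tilt p y x \<le> p (x + t *\<^sub>R y) - t * p y"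
  unfolding tilt_def
proof (rule cINF_lower)
  have "- p (- x) \<le> p (x + t *\<^sub>R y) - t * p y" if "t \<ge> 0" for t
    using sublinear_add[OF p, of "x + t *\<^sub>R y" "- x"] sublinear_scale[OF p that, of y] by simp
  then show "bdd_below ((\<lambda>t. p (x + t *\<^sub>R y) - t * p y) ` {0..})"
    by (intro bdd_belowI[of _ "- p (- x)"]) auto
qed (use assms in auto)

lemma tilt_greatest:
  assumes "\<And>t. t \<ge> 0 \<Longrightarrow> r \<le> p (x + t *\<^sub>R y) - t * p y"
  shows "r \<le> tilt p y x"
  unfolding tilt_def by (rule cINF_greatest) (use assms in auto)

lemma sublinear_tilt:
  assumes p: "sublinear p" shows "sublinear (tilt p y)"
  unfolding sublinear_def
proof (intro conjI allI impI)
  fix x z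
  have "tilt p y (x + z) - (p (z + t *\<^sub>R y) - t * p y) \<le> p (x + s *\<^sub>R y) - s * p y"
    if "s \<ge> 0" "t \<ge> 0" for s t
    using tilt_le[OF p, of "s + t" y "x + z"] that
      sublinear_add[OF p, of "x + s *\<^sub>R y" "z + t *\<^sub>R y"]
    by (simp add: algebra_simps)
  then have "tilt p y (x + z) - (p (z + t *\<^sub>R y) - t * p y) \<le> tilt p y x" if "t \<ge> 0" for t
    using that by (intro tilt_greatest) auto
  then have "tilt p y (x + z) - tilt p y x \<le> p (z + t *\<^sub>R y) - t * p y" if "t \<ge> 0" for t
    using that by (smt (verit))
  then have "tilt p y (x + z) - tilt p y x \<le> tilt p y z"
    by (rule tilt_greatest)
  then show "tilt p y (x + z) \<le> tilt p y x + tilt p y z" by simp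
next
  fix c :: real and x assume c: "c > 0"
  have "inverse c * tilt p y (c *\<^sub>R x) \<le> p (x + t *\<^sub>R y) - t * p y" if "t \<ge> 0" for t
  proof -
    have "tilt p y (c *\<^sub>R x) \<le> p (c *\<^sub>R (x + t *\<^sub>R y)) - (c * t) * p y"
      using tilt_le[OF p, of "c * t" y "c *\<^sub>R x"] c that by (simp add: scaleR_add_right)
    also have "\<dots> = c * (p (x + t *\<^sub>R y) - t * p y)"
      using sublinear_scale[OF p, of c "x + t *\<^sub>R y"] c by (simp add: right_diff_distrib)
    finally show ?thesis using c by (simp add: field_simps)
  qed
  then have "inverse c * tilt p y (c *\<^sub>R x) \<le> tilt p y x" by (rule tilt_greatest)
  then show "tilt p y (c *\<^sub>R x) \<le> c * tilt p y x" using c by (simp add: field_simps)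
qed

text \<open>Minimality makes every tilt trivial, and the term \<open>t = 1\<close> of \<open>tilt p y x\<close> then gives the missing
  inequality \<open>p x + p y \<le> p (x + y)\<close>.\<close>

lemma linear_of_minimal_sublinear:
  assumes p: "sublinear p"
    and min: "\<And>q. sublinear q \<Longrightarrow> q \<le> p \<Longrightarrow> q = p"
  shows "linear p"
proof -
  have "tilt p y \<le> p" for y
    using tilt_le[OF p, of 0 y] by (simp add: le_fun_def)
  then have tilt: "tilt p y = p" for y
    using min sublinear_tilt[OF p] by blast
  have add: "p (x + y) = p x + p y" for x y
    using tilt_le[OF p, of 1 y x] sublinear_add[OF p, of x y] by (simp add: tilt)
  have neg: "p (- x) = - p x" for x
    using add[of x "- x"] sublinear_zero[OF p] by simp
  have "p (c *\<^sub>R x) = c * p x" for c x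
  proof (cases "c \<ge> 0")
    case True then show ?thesis by (rule sublinear_scale[OF p])
  next
    case False
    then show ?thesis using sublinear_scale[OF p, of "- c" x] neg[of "c *\<^sub>R x"] by simp
  qed
  with add show ?thesis by (intro linearI) auto
qed

text \<open>Zorn's lemma applies because the pointwise infimum of a chain is sublinear: it is finite since every
  sublinear \<open>q \<le> p0\<close> satisfies \<open>q x \<ge> - p0 (- x)\<close>, and subadditivity survives since any two members
  of the chain have the smaller of them as a common lower bound.\<close>

lemma minimal_sublinear_exists:
  fixes p0 :: "'a::real_vector \<Rightarrow> real"
  assumes "sublinear p0"
  obtains p where "sublinear p" "p \<le> p0" "\<And>q. sublinear q \<Longrightarrow> q \<le> p \<Longrightarrow> q = p"
proof -
  define A where "A = {q. sublinear q \<and> q \<le> p0}"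
  have "\<exists>m\<in>A. \<forall>a\<in>A. m \<ge> a \<longrightarrow> a = m"
  proof (rule predicate_Zorn)
    show "partial_order_on A (relation_of (\<ge>) A)"
      by (rule partial_order_on_relation_ofI) auto
  next
    fix C assume "C \<in> Chains (relation_of (\<ge>) A)"
    then have sub: "C \<subseteq> A" and ch: "\<And>q r. q \<in> C \<Longrightarrow> r \<in> C \<Longrightarrow> q \<le> r \<or> r \<le> q"
      by (auto simp: Chains_def relation_of_def)
    show "\<exists>u\<in>A. \<forall>a\<in>C. a \<ge> u"
    proof (cases "C = {}")
      case True then show ?thesis using assms by (auto simp: A_def)
    next
      case False
      define u where "u x = (INF q\<in>C. q x)" for x
      have lower: "u x \<le> q x" if "q \<in> C" for q x
        unfolding u_def
      proof (rule cINF_lower)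
        have "- p0 (- x) \<le> q x" if "q \<in> C" for q
        proof -
          have "sublinear q" "q (- x) \<le> p0 (- x)" using that sub by (auto simp: A_def le_fun_def)
          then show ?thesis using sublinear_lower[of q x] by linarith
        qed
        then show "bdd_below ((\<lambda>q. q x) ` C)" by (intro bdd_belowI[of _ "- p0 (- x)"]) auto
      qed (rule that)
      have greatest: "r \<le> u x" if "\<And>q. q \<in> C \<Longrightarrow> r \<le> q x" for r x
        unfolding u_def by (rule cINF_greatest[OF False that])
      have "sublinear u" unfolding sublinear_def
      proof (intro conjI allI impI)
        fix x y
        have "u (x + y) - r y \<le> q x" if qr: "q \<in> C" "r \<in> C" for q r
        proof -
          obtain m where m: "m \<in> C" "m \<le> q" "m \<le> r" using ch[OF qr] qr by auto
          have "u (x + y) \<le> m (x + y)" by (rule lower[OF m(1)])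
          also have "\<dots> \<le> m x + m y" using m(1) sub by (auto simp: A_def sublinear_add)
          also have "\<dots> \<le> q x + r y" using m by (intro add_mono) (auto simp: le_fun_def)
          finally show ?thesis by simp
        qed
        then have "u (x + y) - r y \<le> u x" if "r \<in> C" for r using that by (intro greatest) auto
        then have "u (x + y) - u x \<le> r y" if "r \<in> C" for r using that by (smt (verit))
        then have "u (x + y) - u x \<le> u y" by (rule greatest)
        then show "u (x + y) \<le> u x + u y" by simp
      next
        fix c :: real and x assume c: "c > 0"
        have "inverse c * u (c *\<^sub>R x) \<le> q x" if "q \<in> C" for q
        proof -
          have "q (c *\<^sub>R x) = c * q x" using that sub c by (auto simp: A_def sublinear_scale)
          with lower[OF that, of "c *\<^sub>R x"] show ?thesis using c by (simp add: field_simps)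
        qed
        then have "inverse c * u (c *\<^sub>R x) \<le> u x" by (rule greatest)
        then show "u (c *\<^sub>R x) \<le> c * u x" using c by (simp add: field_simps)
      qed
      moreover have "u \<le> p0"
      proof -
        obtain q where "q \<in> C" using False by blast
        then have "u \<le> q" "q \<le> p0" using lower sub by (auto simp: le_fun_def A_def)
        then show ?thesis by simp
      qed
      ultimately show ?thesis using lower by (auto simp: A_def le_fun_def)
    qed
  qed
  then obtain m where "m \<in> A" "\<forall>a\<in>A. a \<le> m \<longrightarrow> a = m" by blast
  then show thesis by (intro that[of m]) (auto simp: A_def intro: order_trans)
qed

text \<open>The Hahn--Banach theorem in the form needed here.  A minimal sublinear functional below the norm
  tilted along \<open>x0\<close> is linear, is bounded by the norm, and has value at most \<open>- norm x0\<close> at \<open>- x0\<close>.\<close>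

lemma separating_functional:
  fixes x0 :: "'a::real_normed_vector"
  assumes "x0 \<noteq> 0"
  obtains g :: "'a \<Rightarrow> real" where "bounded_linear g" "g x0 > 0"
proof -
  have norm: "sublinear (norm :: 'a \<Rightarrow> real)"
    by (auto simp: sublinear_def norm_triangle_ineq)
  obtain p where p: "sublinear p" "p \<le> tilt norm x0"
    and min: "\<And>q. sublinear q \<Longrightarrow> q \<le> p \<Longrightarrow> q = p"
    using minimal_sublinear_exists[OF sublinear_tilt[OF norm]] by metis
  have lin: "linear p" using p(1) min by (rule linear_of_minimal_sublinear)
  have le: "p x \<le> norm x" for x
    using p(2) tilt_le[OF norm, of 0 x0 x] by (auto simp: le_fun_def intro: order_trans)
  have "\<bar>p x\<bar> \<le> norm x" for x
    using le[of x] le[of "- x"] linear_neg[OF lin, of x] by simp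
  then have "bounded_linear p"
    using lin by (intro linear_conv_bounded_linear[THEN iffD2] bounded_linear_intro[of p 1])
      (auto simp: linear_add linear_scale)
  moreover have "p (- x0) \<le> - norm x0"
    using p(2) tilt_le[OF norm, of 1 x0 "- x0"] by (auto simp: le_fun_def intro: order_trans)
  then have "p x0 > 0" using assms linear_neg[OF lin, of x0] by (smt (verit) norm_eq_zero norm_ge_zero)
  ultimately show thesis by (rule that)
qed

lemma openin_weak_topology_vimage:
  "bounded_linear g \<Longrightarrow> open U \<Longrightarrow> openin weak_topology (g -` U)" for g :: "'a::real_normed_vector \<Rightarrow> real"
  unfolding weak_topology_def by (intro topology_generated_by_Basis) auto

text \<open>If a sequence in the cone converged to a point outside it, then after rescaling it would lie in the
  weakly compact part \<open>K\<close>, and each point of \<open>K\<close> could be separated from the limit by a functional.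
  Finitely many of the resulting weakly open half-spaces cover \<open>K\<close>, yet the sequence eventually
  leaves each of them.\<close>

lemma closed_if_weakly_compact_part:
  fixes P :: "'a::real_normed_vector set"
  assumes P: "convex_cone P" and cpt: "compactin weak_topology (P \<inter> cball 0 1)"
  shows "closed P"
  unfolding closed_sequential_limits
proof (intro allI impI)
  fix s :: "nat \<Rightarrow> 'a" and l assume s: "(\<forall>n. s n \<in> P) \<and> s \<longlonglongrightarrow> l"
  show "l \<in> P"
  proof (rule ccontr)
    assume l: "l \<notin> P"
    from s have "Bseq s" by (intro convergent_imp_Bseq) (auto simp: convergent_def)
    then obtain R where R: "R > 0" "\<And>n. norm (s n) \<le> R" by (auto simp: Bseq_def)
    define k where "k = (\<lambda>n. s n /\<^sub>R R)"
    define K where "K = P \<inter> cball 0 1"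
    have kK: "k n \<in> K" for n
      using s R P by (auto simp: K_def k_def convex_cone_scaleR field_simps)
    have lim: "k \<longlonglongrightarrow> l /\<^sub>R R" unfolding k_def using s by (intro tendsto_intros) auto
    have l': "l /\<^sub>R R \<notin> P"
      using convex_cone_scaleR[OF P, of R "l /\<^sub>R R"] l R by auto
    define \<U> where "\<U> = {g -` {c<..} | (g :: 'a \<Rightarrow> real) c. bounded_linear g \<and> g (l /\<^sub>R R) < c}"
    have op: "openin weak_topology U" if "U \<in> \<U>" for U
      using that by (auto simp: \<U>_def intro!: openin_weak_topology_vimage)
    have cov: "K \<subseteq> \<Union>\<U>"
    proof
      fix y assume "y \<in> K"
      then have "y - l /\<^sub>R R \<noteq> 0" using l' by (auto simp: K_def)
      then obtain g :: "'a \<Rightarrow> real" where g: "bounded_linear g" "g (y - l /\<^sub>R R) > 0"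
        by (rule separating_functional)
      then have "g (l /\<^sub>R R) < g y" by (simp add: bounded_linear.linear linear_diff)
      then obtain c where c: "g (l /\<^sub>R R) < c" "c < g y" using dense by blast
      have "g -` {c<..} \<in> \<U>" using g(1) c(1) unfolding \<U>_def by blast
      moreover have "y \<in> g -` {c<..}" using c(2) by simp
      ultimately show "y \<in> \<Union>\<U>" by (rule UnionI)
    qed
    obtain \<F> where F: "finite \<F>" "\<F> \<subseteq> \<U>" "K \<subseteq> \<Union>\<F>"
      using compactinD[OF cpt[folded K_def] op cov] by blast
    have "\<forall>\<^sub>F n in sequentially. k n \<notin> U" if U: "U \<in> \<F>" for U
    proof -
      obtain g :: "'a \<Rightarrow> real" and c where g: "U = g -` {c<..}" "bounded_linear g" "g (l /\<^sub>R R) < c"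
        using F(2) U unfolding \<U>_def by blast
      have "(\<lambda>n. g (k n)) \<longlonglongrightarrow> g (l /\<^sub>R R)" by (rule bounded_linear.tendsto[OF g(2) lim])
      then have "\<forall>\<^sub>F n in sequentially. g (k n) < c" using g(3) by (rule order_tendstoD)
      then show ?thesis by eventually_elim (simp add: g(1))
    qed
    then have "\<forall>\<^sub>F n in sequentially. \<forall>U\<in>\<F>. k n \<notin> U" using F(1) by (simp add: eventually_ball_finite)
    then obtain n where "\<forall>U\<in>\<F>. k n \<notin> U"
      using eventually_happens'[OF sequentially_bot] by blast
    with F(3) kK show False by blast
  qed
qed

section \<open>Positive linear functionals on a closed generating cone\<close>

lemma convex_cone_sum:
  assumes "convex_cone P" "\<And>i. i \<in> I \<Longrightarrow> s i \<in> P" shows "(\<Sum>i\<in>I. s i) \<in> P"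
  using assms(2)
  by (induction I rule: infinite_finite_induct)
    (auto simp: convex_cone_contains_0[OF assms(1)] intro: convex_cone_add[OF assms(1)])

lemma closed_cone_suminf:
  fixes P :: "'a::real_normed_vector set"
  assumes P: "convex_cone P" "closed P" and s: "\<And>n. s n \<in> P" "summable s"
  shows "suminf s \<in> P"
  by (rule closed_sequentially[OF P(2) _ summable_LIMSEQ[OF s(2)]])
    (auto intro: convex_cone_sum[OF P(1)] s)

text \<open>The Klee--Ando theorem.  The set \<open>D r\<close> of differences of cone elements of norm at most \<open>r\<close> is
  symmetric and convex and the sets \<open>D n\<close> exhaust the space, so by Baire's theorem some
  closure contains a neighbourhood of \<open>0\<close>.  Approximating \<open>x\<close> up to half its norm and repeating
  with the error expresses \<open>x\<close> as a difference of two absolutely convergent series in the cone, whose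
  sums stay in the cone because it is closed.\<close>

lemma generating_closed_cone_decomposition:
  fixes P :: "'a::banach set"
  assumes cone: "convex_cone P" and "closed P" and gen: "generating_cone P"
  obtains C where "\<And>x. \<exists>a\<in>P. \<exists>b\<in>P. x = a - b \<and> norm a \<le> C * norm x \<and> norm b \<le> C * norm x"
proof -
  define D where "D r = {a - b | a b. a \<in> P \<and> b \<in> P \<and> norm a \<le> r \<and> norm b \<le> r}" for r :: real
  have D_diff: "(1/2) *\<^sub>R (u - v) \<in> D r" if uv: "u \<in> D r" "v \<in> D r" for u v r
  proof -
    obtain a b c d where *: "u = a - b" "v = c - d" "a \<in> P" "b \<in> P" "c \<in> P" "d \<in> P"
      "norm a \<le> r" "norm b \<le> r" "norm c \<le> r" "norm d \<le> r"
      using uv unfolding D_def by blast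
    have "(1/2) *\<^sub>R (u - v) = (1/2) *\<^sub>R (a + d) - (1/2) *\<^sub>R (b + c)"
      unfolding *(1,2) by (simp add: algebra_simps)
    moreover have "(1/2) *\<^sub>R (a + d) \<in> P" "(1/2) *\<^sub>R (b + c) \<in> P"
      using * cone by (auto intro!: convex_cone_scaleR convex_cone_add)
    moreover have "norm ((1/2) *\<^sub>R (a + d)) \<le> r" "norm ((1/2) *\<^sub>R (b + c)) \<le> r"
      using * norm_triangle_ineq[of a d] norm_triangle_ineq[of b c] by auto
    ultimately show ?thesis unfolding D_def by blast
  qed
  have "(\<Union>n. closure (D (real n))) = UNIV"
  proof -
    have "\<exists>n. x \<in> closure (D (real n))" for x
    proof -
      obtain a b where ab: "x = a - b" "a \<in> P" "b \<in> P"
        using gen unfolding generating_cone_def by blast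
      obtain n :: nat where "max (norm a) (norm b) \<le> real n" using real_arch_simple by blast
      then have "norm a \<le> real n" "norm b \<le> real n" by auto
      with ab have "x \<in> D (real n)" unfolding D_def by blast
      then show ?thesis using closure_subset by blast
    qed
    then show ?thesis by blast
  qed
  have "\<exists>n. interior (closure (D (real n))) \<noteq> {}"
  proof (rule ccontr)
    assume "\<not> ?thesis"
    then have "(euclidean :: 'a topology) interior_of \<Union>(range (\<lambda>n. closure (D (real n)))) = {}"
      by (intro Baire_category_alt) (auto simp: completely_metrizable_space_euclidean)
    with \<open>(\<Union>n. closure (D (real n))) = UNIV\<close> show False by simp
  qed
  then obtain n z where "z \<in> interior (closure (D (real n)))" by blast
  then obtain e where e: "e > 0" "ball z e \<subseteq> closure (D (real n))"
    by (meson mem_interior)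
  have near0: "\<exists>d\<in>D (real n). norm (y - d) \<le> \<delta>" if "norm y < e" "\<delta> > 0" for y \<delta>
  proof -
    have "z + y \<in> closure (D (real n))" "z - y \<in> closure (D (real n))"
      using e that by (auto simp: dist_norm subset_iff)
    then obtain u v where uv: "u \<in> D (real n)" "dist u (z + y) < \<delta>"
      "v \<in> D (real n)" "dist v (z - y) < \<delta>"
      using \<open>\<delta> > 0\<close> unfolding closure_approachable by meson
    have "(1/2) *\<^sub>R y + (1/2) *\<^sub>R y = y" by (simp flip: scaleR_left_distrib)
    then have "y - (1/2) *\<^sub>R (u - v) = (1/2) *\<^sub>R ((v - (z - y)) - (u - (z + y)))"
      by (simp add: algebra_simps)
    also have "norm \<dots> \<le> \<delta>"
      using uv norm_triangle_ineq4[of "v - (z - y)" "u - (z + y)"] by (simp add: dist_norm)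
    finally show ?thesis using D_diff[OF uv(1,3)] by blast
  qed
  \<comment> \<open>An element of norm \<open>e/2\<close> is nearly a difference of cone elements of norm at most \<open>n\<close>;
    homogeneity turns this into the ratio \<open>K\<close>.\<close>
  define K where "K = 2 * real n / e"
  have K: "K \<ge> 0" using e by (simp add: K_def)
  have "\<exists>a b. a \<in> P \<and> b \<in> P \<and> norm a \<le> K * norm y \<and> norm b \<le> K * norm y
      \<and> norm (y - (a - b)) \<le> norm y / 2" for y
  proof (cases "y = 0")
    case True
    then show ?thesis using convex_cone_contains_0[OF cone] by (intro exI[of _ 0]) auto
  next
    case False
    define t where "t = 2 * norm y / e"
    have t: "t > 0" using False e by (simp add: t_def)
    have "norm (y /\<^sub>R t) = e / 2" using False e by (simp add: t_def field_simps)
    then have "norm (y /\<^sub>R t) < e" "e / 4 > 0" using e by auto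
    then obtain d where d: "d \<in> D (real n)" "norm (y /\<^sub>R t - d) \<le> e / 4" by (meson near0)
    then obtain a b where ab: "d = a - b" "a \<in> P" "b \<in> P" "norm a \<le> n" "norm b \<le> n"
      unfolding D_def by blast
    have "y - (t *\<^sub>R a - t *\<^sub>R b) = t *\<^sub>R (y /\<^sub>R t - d)"
      using t by (simp add: ab algebra_simps)
    then have "norm (y - (t *\<^sub>R a - t *\<^sub>R b)) = t * norm (y /\<^sub>R t - d)"
      using t by (simp only: norm_scaleR)
    also have "\<dots> \<le> t * (e / 4)" using t d by (intro mult_left_mono) auto
    also have "\<dots> = norm y / 2" using e by (simp add: t_def)
    finally have 1: "norm (y - (t *\<^sub>R a - t *\<^sub>R b)) \<le> norm y / 2" .
    have "t * norm a \<le> t * n" "t * norm b \<le> t * n" using t ab by (auto intro: mult_left_mono)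
    moreover have "t * n = K * norm y" by (simp add: t_def K_def)
    ultimately have "norm (t *\<^sub>R a) \<le> K * norm y" "norm (t *\<^sub>R b) \<le> K * norm y"
      using t by auto
    moreover have "t *\<^sub>R a \<in> P" "t *\<^sub>R b \<in> P" using t ab cone by (auto intro: convex_cone_scaleR)
    ultimately show ?thesis using 1 by blast
  qed
  then obtain \<alpha> \<beta> where \<alpha>\<beta>: "\<And>y. \<alpha> y \<in> P" "\<And>y. \<beta> y \<in> P"
    "\<And>y. norm (\<alpha> y) \<le> K * norm y" "\<And>y. norm (\<beta> y) \<le> K * norm y"
    "\<And>y. norm (y - (\<alpha> y - \<beta> y)) \<le> norm y / 2" by metis
  have "\<exists>a\<in>P. \<exists>b\<in>P. x = a - b \<and> norm a \<le> (2 * K) * norm x \<and> norm b \<le> (2 * K) * norm x" for x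
  proof -
    define r where "r = rec_nat x (\<lambda>_ y. y - (\<alpha> y - \<beta> y))"
    have r0: "r 0 = x" and rS: "r (Suc k) = r k - (\<alpha> (r k) - \<beta> (r k))" for k
      by (auto simp: r_def)
    have r: "norm (r k) \<le> norm x * (1/2) ^ k" for k
    proof (induction k)
      case (Suc k)
      then show ?case using \<alpha>\<beta>(5)[of "r k"] by (simp add: rS)
    qed (simp add: r0)
    have geo: "(\<lambda>k. (K * norm x) * (1/2) ^ k) sums ((K * norm x) * (1 / (1 - 1/2)))"
      by (intro sums_mult geometric_sums) simp
    have part: "summable (\<lambda>k. \<gamma> (r k)) \<and> norm (\<Sum>k. \<gamma> (r k)) \<le> (2 * K) * norm x"
      if "\<And>y. norm (\<gamma> y) \<le> K * norm y" for \<gamma> :: "'a \<Rightarrow> 'a"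
    proof -
      have le: "norm (\<gamma> (r k)) \<le> (K * norm x) * (1/2) ^ k" for k
        using that[of "r k"] mult_left_mono[OF r[of k] K] by (simp add: mult.assoc)
      then have sn: "summable (\<lambda>k. norm (\<gamma> (r k)))"
        using geo by (intro summable_comparison_test[OF _ sums_summable[OF geo]]) auto
      have "norm (\<Sum>k. \<gamma> (r k)) \<le> (\<Sum>k. norm (\<gamma> (r k)))" by (rule summable_norm[OF sn])
      also have "\<dots> \<le> (\<Sum>k. (K * norm x) * (1/2) ^ k)"
        using le sn sums_summable[OF geo] by (rule suminf_le)
      also have "\<dots> = (2 * K) * norm x" using sums_unique[OF geo] by simp
      finally show ?thesis using summable_norm_cancel[OF sn] by blast
    qed
    have \<alpha>: "summable (\<lambda>k. \<alpha> (r k))" "norm (\<Sum>k. \<alpha> (r k)) \<le> (2 * K) * norm x"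
      and \<beta>: "summable (\<lambda>k. \<beta> (r k))" "norm (\<Sum>k. \<beta> (r k)) \<le> (2 * K) * norm x"
      using part[of \<alpha>] part[of \<beta>] \<alpha>\<beta> by auto
    have "(\<Sum>k<m. \<alpha> (r k) - \<beta> (r k)) = x - r m" for m
      by (induction m) (auto simp: r0 rS)
    moreover have "r \<longlonglongrightarrow> 0"
    proof (rule Lim_null_comparison)
      show "\<forall>\<^sub>F k in sequentially. norm (r k) \<le> norm x * (1/2) ^ k" using r by simp
      show "(\<lambda>k. norm x * (1/2) ^ k) \<longlonglongrightarrow> 0"
        by (intro tendsto_mult_right_zero LIMSEQ_power_zero) simp
    qed
    ultimately have "(\<lambda>k. \<alpha> (r k) - \<beta> (r k)) sums (x - 0)"
      unfolding sums_def by (simp only: tendsto_diff[OF tendsto_const])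
    then have "x = (\<Sum>k. \<alpha> (r k)) - (\<Sum>k. \<beta> (r k))"
      using suminf_diff[OF \<alpha>(1) \<beta>(1)] sums_unique by force
    moreover have "(\<Sum>k. \<alpha> (r k)) \<in> P" "(\<Sum>k. \<beta> (r k)) \<in> P"
      using \<alpha>(1) \<beta>(1) \<alpha>\<beta> by (auto intro: closed_cone_suminf[OF cone \<open>closed P\<close>])
    ultimately show ?thesis using \<alpha>(2) \<beta>(2) by blast
  qed
  then show thesis by (rule that)
qed

text \<open>Automatic continuity.  Were \<open>g\<close> unbounded relative to the norm on the cone, there would be elements
  \<open>s n\<close> of the cone with norm \<open>1/2^n\<close> and \<open>g (s n) \<ge> 1\<close>; their sum lies in the closed cone and
  dominates all partial sums, so \<open>g\<close> would be infinite there.  The decomposition theorem carries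
  the bound from the cone to the whole space.\<close>

lemma positive_linear_bounded:
  fixes P :: "'a::banach set" and g :: "'a \<Rightarrow> real"
  assumes cone: "convex_cone P" and "closed P" and gen: "generating_cone P"
    and lin: "linear g" and nonneg: "\<And>x. x \<in> P \<Longrightarrow> g x \<ge> 0"
  shows "bounded_linear g"
proof -
  have "\<exists>L. \<forall>y\<in>P. g y \<le> L * norm y"
  proof (rule ccontr)
    assume "\<not> ?thesis"
    then have "\<exists>y\<in>P. g y > 2 ^ n * norm y" for n :: nat by (meson not_le)
    then obtain y where y: "\<And>n. y n \<in> P" "\<And>n. g (y n) > 2 ^ n * norm (y n)" by metis
    define s where "s n = ((1/2) ^ n / norm (y n)) *\<^sub>R y n" for n
    have y0: "norm (y n) > 0" for n using y(2)[of n] linear_0[OF lin] by auto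
    have sP: "s n \<in> P" for n unfolding s_def using y y0 by (intro convex_cone_scaleR[OF cone]) auto
    have norm_s: "norm (s n) = (1/2) ^ n" for n using y0[of n] by (simp add: s_def)
    have "summable (\<lambda>n. norm (s n))" unfolding norm_s by (rule summable_geometric) simp
    then have sum: "summable s" by (rule summable_norm_cancel)
    have s1: "g (s n) \<ge> 1" for n
    proof -
      have "(1/2) ^ n * 2 ^ n = (1::real)" by (induction n) auto
      then have "norm (y n) = (1/2) ^ n * (2 ^ n * norm (y n))"
        by (simp only: mult.assoc[symmetric] mult_1)
      also have "\<dots> \<le> (1/2) ^ n * g (y n)"
        using y(2)[of n] by (intro mult_left_mono) auto
      finally show ?thesis using y0[of n] by (simp add: s_def linear_scale[OF lin])
    qed
    have "real n \<le> g (suminf s)" for n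
    proof -
      have "suminf s = (\<Sum>k. s (k + n)) + sum s {..<n}" by (rule suminf_split_initial_segment[OF sum])
      moreover have "(\<Sum>k. s (k + n)) \<in> P"
        using sum sP by (intro closed_cone_suminf[OF cone \<open>closed P\<close>]) (auto simp: summable_iff_shift)
      ultimately have "g (suminf s) \<ge> g (sum s {..<n})"
        using nonneg by (simp add: linear_add[OF lin])
      also have "g (sum s {..<n}) = (\<Sum>k<n. g (s k))" by (rule linear_sum[OF lin])
      also have "\<dots> \<ge> (\<Sum>k<n. 1)" using s1 by (intro sum_mono)
      finally show ?thesis by simp
    qed
    then show False by (meson reals_Archimedean2 not_le)
  qed
  then obtain L where L: "\<And>y. y \<in> P \<Longrightarrow> g y \<le> L * norm y" by blast
  obtain C where C: "\<And>x. \<exists>a\<in>P. \<exists>b\<in>P. x = a - b \<and> norm a \<le> C * norm x \<and> norm b \<le> C * norm x"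
    by (rule generating_closed_cone_decomposition[OF cone \<open>closed P\<close> gen]) blast
  have "norm (g x) \<le> norm x * (\<bar>L\<bar> * C)" for x
  proof -
    obtain a b where ab: "a \<in> P" "b \<in> P" "x = a - b" "norm a \<le> C * norm x" "norm b \<le> C * norm x"
      using C by blast
    have *: "0 \<le> g u \<and> g u \<le> \<bar>L\<bar> * (C * norm x)" if "u \<in> P" "norm u \<le> C * norm x" for u
    proof -
      have "L * norm u \<le> \<bar>L\<bar> * norm u" by (intro mult_right_mono) auto
      also have "\<dots> \<le> \<bar>L\<bar> * (C * norm x)" using that by (intro mult_left_mono) auto
      finally show ?thesis using L nonneg that by force
    qed
    have "g x = g a - g b" unfolding ab(3) by (rule linear_diff[OF lin])
    then have "norm (g x) \<le> \<bar>L\<bar> * (C * norm x)" using *[OF ab(1,4)] *[OF ab(2,5)] by auto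
    then show ?thesis by (simp add: ac_simps)
  qed
  then show ?thesis using lin by (intro bounded_linear_intro) (auto simp: linear_add linear_scale)
qed

lemma linear_extension_from_cone:
  fixes \<psi> :: "'a::real_vector \<Rightarrow> real"
  assumes cone: "convex_cone P" and gen: "generating_cone P"
    and add: "\<And>x y. x \<in> P \<Longrightarrow> y \<in> P \<Longrightarrow> \<psi> (x + y) = \<psi> x + \<psi> y"
    and scale: "\<And>c x. c > 0 \<Longrightarrow> x \<in> P \<Longrightarrow> \<psi> (c *\<^sub>R x) = c * \<psi> x"
  obtains g where "linear g" "\<And>x. x \<in> P \<Longrightarrow> g x = \<psi> x"
proof -
  have "\<exists>a b. a \<in> P \<and> b \<in> P \<and> x = a - b" for x
    using gen unfolding generating_cone_def by blast
  then obtain \<alpha> \<beta> where ab: "\<And>x. \<alpha> x \<in> P" "\<And>x. \<beta> x \<in> P" "\<And>x. x = \<alpha> x - \<beta> x" by metis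
  define g where "g x = \<psi> (\<alpha> x) - \<psi> (\<beta> x)" for x
  have g: "g (a - b) = \<psi> a - \<psi> b" if "a \<in> P" "b \<in> P" for a b
  proof -
    have "\<alpha> (a - b) + b = a + \<beta> (a - b)" using ab(3)[of "a - b"] by (simp add: algebra_simps)
    then have "\<psi> (\<alpha> (a - b)) + \<psi> b = \<psi> a + \<psi> (\<beta> (a - b))" using add that ab by metis
    then show ?thesis by (simp add: g_def)
  qed
  have \<psi>0: "\<psi> 0 = 0" using add[of 0 0] convex_cone_contains_0[OF cone] by simp
  have gadd: "g (x + y) = g x + g y" for x y
  proof -
    have "x + y = (\<alpha> x + \<alpha> y) - (\<beta> x + \<beta> y)" using ab(3)[of x] ab(3)[of y] by (simp add: algebra_simps)
    then have "g (x + y) = \<psi> (\<alpha> x + \<alpha> y) - \<psi> (\<beta> x + \<beta> y)"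
      using g ab convex_cone_add[OF cone] by metis
    then show ?thesis using add ab by (simp add: g_def)
  qed
  have pos: "g (c *\<^sub>R x) = c * g x" if c: "c > 0" for c x
  proof -
    have "c *\<^sub>R x = c *\<^sub>R \<alpha> x - c *\<^sub>R \<beta> x" using ab(3)[of x] by (metis scaleR_diff_right)
    then have "g (c *\<^sub>R x) = \<psi> (c *\<^sub>R \<alpha> x) - \<psi> (c *\<^sub>R \<beta> x)"
      using g ab convex_cone_scaleR[OF cone] c by (metis less_imp_le)
    then show ?thesis using scale[OF c] ab by (simp add: g_def right_diff_distrib)
  qed
  have g0: "g 0 = 0" using gadd[of 0 0] by simp
  have neg: "g (- x) = - g x" for x using gadd[of x "- x"] g0 by simp
  have "g (c *\<^sub>R x) = c * g x" for c x
  proof (cases c "0 :: real" rule: linorder_cases)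
    case less
    then show ?thesis using pos[of "- c" x] neg[of "c *\<^sub>R x"] by simp
  qed (auto simp: g0 pos)
  then have "linear g" using gadd by (intro linearI) auto
  moreover have "g x = \<psi> x" if "x \<in> P" for x
    using g[of x 0] that convex_cone_contains_0[OF cone] \<psi>0 by simp
  ultimately show thesis by (rule that)
qed

text \<open>The functional is the one that sends \<open>x\<close> to the unique \<open>t\<close> with \<open>x /\<^sub>R t\<close> in the base.  It is
  additive because \<open>x + y\<close>, divided by the sum of the two values, is a convex combination of base
  elements; a bound for the base gives the estimate of the norm.\<close>

lemma bounded_base_functional:
  fixes P :: "'a::real_normed_vector set"
  assumes cone: "convex_cone P" and gen: "generating_cone P"
    and pointed: "\<And>x. x \<in> P \<Longrightarrow> - x \<in> P \<Longrightarrow> x = 0"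
    and base: "cone_base P B" and "bounded B"
  obtains f :: "'a \<Rightarrow> real" and M where "linear f" "M > 0"
    "\<And>x. x \<in> P \<Longrightarrow> norm x \<le> M * f x"
proof -
  define \<psi> where "\<psi> x = (if x = 0 then 0 else THE t. t > 0 \<and> x /\<^sub>R t \<in> B)" for x
  have ex1: "\<exists>!t. t > 0 \<and> x /\<^sub>R t \<in> B" if "x \<in> P" "x \<noteq> 0" for x
    using base that by (auto simp: cone_base_def)
  have \<psi>: "\<psi> x > 0" "x /\<^sub>R \<psi> x \<in> B" if "x \<in> P" "x \<noteq> 0" for x
    using theI'[OF ex1[OF that]] that by (auto simp: \<psi>_def)
  have \<psi>_eq: "\<psi> x = t" if "x \<in> P" "x \<noteq> 0" "t > 0" "x /\<^sub>R t \<in> B" for x t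
    using ex1[OF that(1,2)] \<psi>[OF that(1,2)] that by blast
  obtain g where g: "linear g" "\<And>x. x \<in> P \<Longrightarrow> g x = \<psi> x"
  proof (rule linear_extension_from_cone[OF cone gen, of \<psi>])
    fix x y assume xy: "x \<in> P" "y \<in> P"
    show "\<psi> (x + y) = \<psi> x + \<psi> y"
    proof (cases "x = 0 \<or> y = 0")
      case True
      have "\<psi> 0 = 0" by (simp add: \<psi>_def)
      with True show ?thesis by auto
    next
      case False
      then have pos: "\<psi> x > 0" "\<psi> y > 0" using \<psi> xy by auto
      have ne: "x + y \<noteq> 0" using pointed[of x] xy False by (metis add_eq_0_iff)
      have "(x + y) /\<^sub>R (\<psi> x + \<psi> y) = (\<psi> x / (\<psi> x + \<psi> y)) *\<^sub>R (x /\<^sub>R \<psi> x)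
          + (\<psi> y / (\<psi> x + \<psi> y)) *\<^sub>R (y /\<^sub>R \<psi> y)"
        using pos by (simp add: field_simps scaleR_add_right)
      also have "\<dots> \<in> B"
      proof (rule convexD)
        show "convex B" using base by (simp add: cone_base_def)
        show "\<psi> x / (\<psi> x + \<psi> y) + \<psi> y / (\<psi> x + \<psi> y) = 1"
          using pos by (simp add: add_divide_distrib[symmetric])
        show "\<psi> x / (\<psi> x + \<psi> y) \<ge> 0" "\<psi> y / (\<psi> x + \<psi> y) \<ge> 0" using pos by simp_all
      qed (use \<psi> xy False in auto)
      finally show ?thesis
        using pos ne convex_cone_add[OF cone] xy by (intro \<psi>_eq) auto
    qed
  next
    fix c :: real and x assume c: "c > 0" and x: "x \<in> P"
    show "\<psi> (c *\<^sub>R x) = c * \<psi> x"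
    proof (cases "x = 0")
      case False
      have "(c *\<^sub>R x) /\<^sub>R (c * \<psi> x) = x /\<^sub>R \<psi> x" using c by simp
      then have "(c *\<^sub>R x) /\<^sub>R (c * \<psi> x) \<in> B" using \<psi>(2)[OF x False] by (simp only:)
      moreover have "c *\<^sub>R x \<in> P" "c *\<^sub>R x \<noteq> 0" "c * \<psi> x > 0"
        using \<psi>(1)[OF x False] c x False by (simp_all add: convex_cone_scaleR[OF cone])
      ultimately show ?thesis by (intro \<psi>_eq)
    qed (simp add: \<psi>_def)
  qed blast
  obtain M where M: "M > 0" "\<And>b. b \<in> B \<Longrightarrow> norm b \<le> M"
    using \<open>bounded B\<close> by (auto simp: bounded_pos)
  have "norm x \<le> M * g x" if x: "x \<in> P" for x
  proof (cases "x = 0")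
    case False
    then have "\<psi> x > 0" "norm (x /\<^sub>R \<psi> x) \<le> M" using M(2) \<psi> x by blast+
    then show ?thesis using g(2)[OF x] by (simp add: field_simps)
  qed (simp add: linear_0[OF g(1)])
  with g(1) M(1) show thesis by (rule that)
qed

section \<open>Cones that induce a lattice order\<close>

text \<open>Order and infimum are parameters tied to the cone, as the ambient type carries no order of its own.
  The positive part of \<open>x\<close> appears as \<open>x - meet x 0\<close> and
  the negative part as \<open>- meet x 0\<close>.\<close>

locale riesz_cone =
  fixes P :: "'a::real_vector set" and meet :: "'a \<Rightarrow> 'a \<Rightarrow> 'a"
  assumes cone: "convex_cone P"
    and pointed: "x \<in> P \<Longrightarrow> - x \<in> P \<Longrightarrow> x = 0"
    and meet_le1: "cone_le P (meet x y) x"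
    and meet_le2: "cone_le P (meet x y) y"
    and meet_greatest: "cone_le P z x \<Longrightarrow> cone_le P z y \<Longrightarrow> cone_le P z (meet x y)"
begin

abbreviation le (infix "\<sqsubseteq>" 50) where "x \<sqsubseteq> y \<equiv> cone_le P x y"

lemma zero_le [simp]: "0 \<sqsubseteq> x \<longleftrightarrow> x \<in> P"
  by (simp add: cone_le_def)

lemma le_refl [simp]: "x \<sqsubseteq> x"
  by (simp add: cone_le_def convex_cone_contains_0[OF cone])

lemma le_trans [trans]: "x \<sqsubseteq> y \<Longrightarrow> y \<sqsubseteq> z \<Longrightarrow> x \<sqsubseteq> z"
  using convex_cone_add[OF cone, of "y - x" "z - y"] by (simp add: cone_le_def)

lemma le_antisym: "x \<sqsubseteq> y \<Longrightarrow> y \<sqsubseteq> x \<Longrightarrow> x = y"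
  using pointed[of "y - x"] by (simp add: cone_le_def)

lemma le_add_mono: "x \<sqsubseteq> y \<Longrightarrow> u \<sqsubseteq> v \<Longrightarrow> x + u \<sqsubseteq> y + v"
  using convex_cone_add[OF cone, of "y - x" "v - u"] by (simp add: cone_le_def algebra_simps)

lemma le_diff_iff: "x - z \<sqsubseteq> y \<longleftrightarrow> x \<sqsubseteq> y + z"
  by (simp add: cone_le_def algebra_simps)

lemma le_scale_mono: "x \<sqsubseteq> y \<Longrightarrow> c \<ge> 0 \<Longrightarrow> c *\<^sub>R x \<sqsubseteq> c *\<^sub>R y"
  using convex_cone_scaleR[OF cone, of c "y - x"] by (simp add: cone_le_def algebra_simps)

lemma meet_in: "x \<in> P \<Longrightarrow> y \<in> P \<Longrightarrow> meet x y \<in> P"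
  using meet_greatest[of 0 x y] by simp

lemma meet_mono: "x \<sqsubseteq> x' \<Longrightarrow> y \<sqsubseteq> y' \<Longrightarrow> meet x y \<sqsubseteq> meet x' y'"
  by (meson le_trans meet_greatest meet_le1 meet_le2)

lemma meet_self: "meet x x = x"
  by (intro le_antisym meet_le1 meet_greatest le_refl)

lemma meet_diff: "meet (x - z) (y - z) = meet x y - z"
proof (rule le_antisym)
  have "meet (x - z) (y - z) + z \<sqsubseteq> meet x y"
    using le_add_mono[OF meet_le1 le_refl, of "x - z" "y - z" z]
      le_add_mono[OF meet_le2 le_refl, of "x - z" "y - z" z]
    by (intro meet_greatest) auto
  then show "meet (x - z) (y - z) \<sqsubseteq> meet x y - z"
    by (simp add: cone_le_def algebra_simps)
  show "meet x y - z \<sqsubseteq> meet (x - z) (y - z)"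
    by (intro meet_greatest) (simp_all add: le_diff_iff meet_le1 meet_le2)
qed

lemma meet_add_le:
  assumes "x \<in> P" "y \<in> P" "v \<in> P"
  shows "meet (x + y) v \<sqsubseteq> meet x v + meet y v"
proof -
  let ?w = "meet (x + y) v"
  have "?w - x \<sqsubseteq> meet y v"
  proof (rule meet_greatest)
    show "?w - x \<sqsubseteq> y" using meet_le1[of "x + y" v] by (simp add: le_diff_iff add.commute)
    have "v \<sqsubseteq> v + x" using assms by (simp add: cone_le_def)
    with meet_le2[of "x + y" v] show "?w - x \<sqsubseteq> v" by (auto simp: le_diff_iff intro: le_trans)
  qed
  then have "?w - meet y v \<sqsubseteq> x" by (simp add: le_diff_iff add.commute)
  moreover have "?w - meet y v \<sqsubseteq> v"
  proof -
    have "v \<sqsubseteq> v + meet y v" using assms by (simp add: cone_le_def meet_in)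
    with meet_le2[of "x + y" v] show ?thesis by (auto simp: le_diff_iff intro: le_trans)
  qed
  ultimately have "?w - meet y v \<sqsubseteq> meet x v" by (rule meet_greatest)
  then show ?thesis by (simp add: le_diff_iff)
qed

lemma meet_commute: "meet x y = meet y x"
  by (intro le_antisym meet_greatest meet_le1 meet_le2)

lemma disjoint_mono:
  assumes "meet x y = 0" "x' \<sqsubseteq> x" "y' \<sqsubseteq> y" "x' \<in> P" "y' \<in> P"
  shows "meet x' y' = 0"
proof (rule le_antisym)
  show "meet x' y' \<sqsubseteq> 0" using meet_mono[OF assms(2,3)] assms(1) by simp
  show "0 \<sqsubseteq> meet x' y'" using meet_in assms by simp
qed

lemma disjoint_add:
  assumes "meet z v = 0" "meet z w = 0" "z \<in> P" "v \<in> P" "w \<in> P"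
  shows "meet z (v + w) = 0"
proof (rule le_antisym)
  show "meet z (v + w) \<sqsubseteq> 0" using meet_add_le[of v w z] assms by (simp add: meet_commute)
  show "0 \<sqsubseteq> meet z (v + w)" using assms by (simp add: meet_in convex_cone_add[OF cone])
qed

lemma disjoint_scale:
  assumes zv: "meet z v = 0" "z \<in> P" "v \<in> P" and c: "c \<ge> 0"
  shows "meet z (c *\<^sub>R v) = 0"
proof (rule le_antisym)
  define d where "d = c + 1"
  have d: "d > 0" using c by (simp add: d_def)
  have "inverse d *\<^sub>R meet z (c *\<^sub>R v) \<sqsubseteq> meet z v"
  proof (rule meet_greatest)
    have "inverse d *\<^sub>R meet z (c *\<^sub>R v) \<sqsubseteq> inverse d *\<^sub>R (d *\<^sub>R z)"
    proof (intro le_scale_mono)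
      have "d *\<^sub>R z - z \<in> P" using zv c convex_cone_scaleR[OF cone, of c z]
        by (simp add: d_def scaleR_left_distrib)
      then have "z \<sqsubseteq> d *\<^sub>R z" by (simp add: cone_le_def)
      with meet_le1 show "meet z (c *\<^sub>R v) \<sqsubseteq> d *\<^sub>R z" by (rule le_trans)
    qed (use d in simp)
    then show "inverse d *\<^sub>R meet z (c *\<^sub>R v) \<sqsubseteq> z" using d by simp
    have "inverse d *\<^sub>R meet z (c *\<^sub>R v) \<sqsubseteq> inverse d *\<^sub>R (d *\<^sub>R v)"
    proof (intro le_scale_mono)
      have "d *\<^sub>R v - c *\<^sub>R v \<in> P" using zv by (simp add: d_def scaleR_left_distrib)
      then have "c *\<^sub>R v \<sqsubseteq> d *\<^sub>R v" by (simp add: cone_le_def)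
      with meet_le2 show "meet z (c *\<^sub>R v) \<sqsubseteq> d *\<^sub>R v" by (rule le_trans)
    qed (use d in simp)
    then show "inverse d *\<^sub>R meet z (c *\<^sub>R v) \<sqsubseteq> v" using d by simp
  qed
  then have "d *\<^sub>R (inverse d *\<^sub>R meet z (c *\<^sub>R v)) \<sqsubseteq> d *\<^sub>R 0"
    unfolding zv(1) by (rule le_scale_mono) (use d in simp)
  then show "meet z (c *\<^sub>R v) \<sqsubseteq> 0" using d by simp
  show "0 \<sqsubseteq> meet z (c *\<^sub>R v)" using zv c by (simp add: meet_in convex_cone_scaleR[OF cone])
qed

text \<open>This holds because the elements of \<open>P\<close> that are disjoint from \<open>z\<close> form a convex cone.\<close>

lemma disjoint_hull:
  assumes z: "z \<in> P" and S: "\<And>x. x \<in> S \<Longrightarrow> x \<in> P \<and> meet z x = 0"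
    and v: "v \<in> convex_cone hull S"
  shows "meet z v = 0"
proof -
  have "convex_cone {v \<in> P. meet z v = 0}"
    unfolding convex_cone_iff
  proof (intro conjI ballI allI impI)
    have "meet z 0 = 0"
      using z meet_in[OF z convex_cone_contains_0[OF cone]] meet_le2[of z 0]
      by (intro le_antisym) auto
    then show "0 \<in> {v \<in> P. meet z v = 0}" using convex_cone_contains_0[OF cone] by simp
  qed (use z in \<open>auto intro: convex_cone_add[OF cone] disjoint_add convex_cone_scaleR[OF cone] disjoint_scale\<close>)
  then have "convex_cone hull S \<subseteq> {v \<in> P. meet z v = 0}"
    using S by (intro hull_minimal) auto
  with v show ?thesis by blast
qed

lemma disjoint_add_le:
  assumes "meet a b = 0" "a \<sqsubseteq> x" "b \<sqsubseteq> x" shows "a + b \<sqsubseteq> x"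
proof -
  have "a + b - x \<sqsubseteq> meet a b"
    using le_add_mono[OF le_refl assms(3), of a] le_add_mono[OF assms(2) le_refl, of b]
    by (intro meet_greatest) (simp_all add: le_diff_iff add.commute)
  then show ?thesis by (simp add: assms(1) le_diff_iff)
qed

lemma disjoint_sum_le:
  assumes "finite M" "pairwise (\<lambda>a b. meet a b = 0) M"
    and "\<And>a. a \<in> M \<Longrightarrow> a \<in> P \<and> c a \<ge> 0 \<and> c a *\<^sub>R a \<sqsubseteq> x" and "x \<in> P"
  shows "(\<Sum>a\<in>M. c a *\<^sub>R a) \<sqsubseteq> x"
  using assms(1,2,3)
proof (induction M)
  case (insert a M)
  have "(\<Sum>b\<in>M. c b *\<^sub>R b) \<in> convex_cone hull M"
    using insert.prems by (intro convex_cone_sum convex_cone_convex_cone_hull convex_cone_hull_mul hull_inc) auto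
  moreover have "meet a b = 0" if "b \<in> M" for b
    using insert that by (auto simp: pairwise_def)
  ultimately have "meet a (\<Sum>b\<in>M. c b *\<^sub>R b) = 0"
    using insert.prems by (intro disjoint_hull[of a M]) auto
  moreover have "(\<Sum>b\<in>M. c b *\<^sub>R b) \<in> P"
    using insert.prems by (intro convex_cone_sum[OF cone] convex_cone_scaleR[OF cone]) auto
  ultimately have "meet (c a *\<^sub>R a) (\<Sum>b\<in>M. c b *\<^sub>R b) = 0"
    using insert.prems disjoint_scale[of "\<Sum>b\<in>M. c b *\<^sub>R b" a "c a"] by (simp add: meet_commute)
  moreover have "(\<Sum>b\<in>M. c b *\<^sub>R b) \<sqsubseteq> x"
    using insert by (auto simp: pairwise_insert)
  ultimately show ?case
    using insert by (simp add: disjoint_add_le)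
qed (use assms in simp)

text \<open>The supremum over \<open>v \<in> V\<close> of \<open>f (meet x v)\<close> is the value of \<open>f\<close> at the projection of \<open>x\<close> onto the
  band generated by \<open>V\<close>.  It is subadditive by the Riesz inequality \<open>meet_add_le\<close>, and superadditive
  because \<open>V\<close> is closed under addition.\<close>

lemma band_functional:
  fixes f :: "'a \<Rightarrow> real"
  assumes gen: "generating_cone P" and lin: "linear f" and pos: "\<And>x. x \<in> P \<Longrightarrow> f x \<ge> 0"
    and V: "convex_cone V" "V \<subseteq> P"
  obtains g where "linear g"
    "\<And>x v. x \<in> P \<Longrightarrow> v \<in> V \<Longrightarrow> f (meet x v) \<le> g x"
    "\<And>x r. x \<in> P \<Longrightarrow> (\<And>v. v \<in> V \<Longrightarrow> f (meet x v) \<le> r) \<Longrightarrow> g x \<le> r"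
proof -
  have mono: "f x \<le> f y" if "x \<sqsubseteq> y" for x y
    using pos[of "y - x"] that by (simp add: cone_le_def linear_diff[OF lin])
  define \<psi> where "\<psi> x = (SUP v\<in>V. f (meet x v))" for x
  have V0: "V \<noteq> {}" using V by (simp add: convex_cone_nonempty)
  have upper: "f (meet x v) \<le> \<psi> x" if "v \<in> V" for x v
    unfolding \<psi>_def using that
    by (intro cSUP_upper bdd_aboveI2[of _ _ "f x"] mono meet_le1)
  have least: "\<psi> x \<le> r" if "\<And>v. v \<in> V \<Longrightarrow> f (meet x v) \<le> r" for x r
    unfolding \<psi>_def using V0 that by (intro cSUP_least)
  obtain g where g: "linear g" "\<And>x. x \<in> P \<Longrightarrow> g x = \<psi> x"
  proof (rule linear_extension_from_cone[OF cone gen, of \<psi>])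
    fix x y assume xy: "x \<in> P" "y \<in> P"
    show "\<psi> (x + y) = \<psi> x + \<psi> y"
    proof (rule antisym)
      have "f (meet (x + y) v) \<le> \<psi> x + \<psi> y" if v: "v \<in> V" for v
      proof -
        have "f (meet (x + y) v) \<le> f (meet x v + meet y v)"
          using xy V v by (intro mono meet_add_le) auto
        also have "\<dots> \<le> \<psi> x + \<psi> y"
          unfolding linear_add[OF lin] using v by (intro add_mono upper)
        finally show ?thesis .
      qed
      then show "\<psi> (x + y) \<le> \<psi> x + \<psi> y" by (rule least)
      have "f (meet x v) + f (meet y w) \<le> \<psi> (x + y)" if vw: "v \<in> V" "w \<in> V" for v w
      proof -
        have "meet x v + meet y w \<sqsubseteq> meet (x + y) (v + w)"
          by (intro meet_greatest le_add_mono meet_le1 meet_le2)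
        then have "f (meet x v) + f (meet y w) \<le> f (meet (x + y) (v + w))"
          using mono by (simp flip: linear_add[OF lin])
        also have "\<dots> \<le> \<psi> (x + y)" using vw by (intro upper convex_cone_add[OF V(1)])
        finally show ?thesis .
      qed
      then have "f (meet x v) \<le> \<psi> (x + y) - f (meet y w)" if "v \<in> V" "w \<in> V" for v w
        using that by (simp add: le_diff_eq)
      then have "\<psi> x \<le> \<psi> (x + y) - f (meet y w)" if "w \<in> V" for w
        using that by (intro least)
      then have "f (meet y w) \<le> \<psi> (x + y) - \<psi> x" if "w \<in> V" for w
        using that by (smt (verit))
      then have "\<psi> y \<le> \<psi> (x + y) - \<psi> x" by (rule least)
      then show "\<psi> x + \<psi> y \<le> \<psi> (x + y)" by simp
    qed
  next
    have le: "c * \<psi> x \<le> \<psi> (c *\<^sub>R x)" if c: "c > 0" for c x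
    proof -
      have "f (meet x v) \<le> \<psi> (c *\<^sub>R x) / c" if v: "v \<in> V" for v
      proof -
        have "c *\<^sub>R meet x v \<sqsubseteq> meet (c *\<^sub>R x) (c *\<^sub>R v)"
          using c by (intro meet_greatest le_scale_mono meet_le1 meet_le2) auto
        then have "c * f (meet x v) \<le> f (meet (c *\<^sub>R x) (c *\<^sub>R v))"
          using mono linear_scale[OF lin, of c "meet x v"] by fastforce
        also have "\<dots> \<le> \<psi> (c *\<^sub>R x)"
          using v c by (intro upper convex_cone_scaleR[OF V(1)]) auto
        finally show ?thesis using c by (simp add: pos_le_divide_eq mult.commute)
      qed
      then have "\<psi> x \<le> \<psi> (c *\<^sub>R x) / c" by (rule least)
      then show ?thesis using c by (simp add: pos_le_divide_eq mult.commute)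
    qed
    fix c :: real and x assume c: "c > 0"
    have "inverse c * \<psi> (c *\<^sub>R x) \<le> \<psi> x" using le[of "inverse c" "c *\<^sub>R x"] c by simp
    then have "\<psi> (c *\<^sub>R x) \<le> c * \<psi> x" using c by (simp add: inverse_eq_divide pos_divide_le_eq mult.commute)
    with le[OF c] show "\<psi> (c *\<^sub>R x) = c * \<psi> x" by (rule antisym[rotated])
  qed blast
  show thesis
    by (rule that[OF g(1)]) (use g(2) upper least in auto)
qed

end

locale closed_riesz_cone = riesz_cone P meet
  for P :: "'a::real_normed_vector set" and meet +
  assumes closed: "closed P"
begin

lemma closed_multiples: "closed {t. t *\<^sub>R u \<sqsubseteq> v}" "closed {t. v \<sqsubseteq> t *\<^sub>R u}"
proof -
  have "closed ((\<lambda>t. v - t *\<^sub>R u) -` P)" "closed ((\<lambda>t. t *\<^sub>R u - v) -` P)"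
    by (intro closed_vimage[OF closed] continuous_intros)+
  then show "closed {t. t *\<^sub>R u \<sqsubseteq> v}" "closed {t. v \<sqsubseteq> t *\<^sub>R u}"
    by (simp_all add: cone_le_def vimage_def)
qed

definition atom :: "'a \<Rightarrow> bool" where
  "atom a \<longleftrightarrow> a \<in> P \<and> a \<noteq> 0 \<and> (\<forall>v\<in>P. v \<sqsubseteq> a \<longrightarrow> (\<exists>t. v = t *\<^sub>R a))"

text \<open>Suppose \<open>0 \<sqsubseteq> v \<sqsubseteq> u\<close> and \<open>v\<close> is not a multiple of \<open>u\<close>.  Then some \<open>t *\<^sub>R u\<close> is incomparable with \<open>v\<close>, and
  the positive and negative parts of \<open>v - t *\<^sub>R u\<close> are the two pieces.  The existence of \<open>t\<close> is
  the connectedness of \<open>{0..1}\<close>: the sets where \<open>t *\<^sub>R u \<sqsubseteq> v\<close> and where \<open>v \<sqsubseteq> t *\<^sub>R u\<close> are closed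
  and contain \<open>0\<close> and \<open>1\<close> respectively, and at a common point \<open>v\<close> would be a multiple of \<open>u\<close>.\<close>

lemma split_non_atom:
  assumes u: "u \<in> P" "u \<noteq> 0" "\<not> atom u"
  obtains a b where "a \<in> P" "a \<noteq> 0" "a \<sqsubseteq> u" "b \<in> P" "b \<noteq> 0" "b \<sqsubseteq> u" "meet a b = 0"
proof -
  obtain v where v: "v \<in> P" "v \<sqsubseteq> u" "\<And>t. v \<noteq> t *\<^sub>R u"
    using u by (auto simp: atom_def)
  have "\<exists>t\<in>{0..1}. \<not> t *\<^sub>R u \<sqsubseteq> v \<and> \<not> v \<sqsubseteq> t *\<^sub>R u"
  proof (rule ccontr)
    assume neg: "\<not> ?thesis"
    let ?A = "{t. t *\<^sub>R u \<sqsubseteq> v}" and ?B = "{t. v \<sqsubseteq> t *\<^sub>R u}"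
    have "{0..1} \<subseteq> ?A \<union> ?B" using neg by blast
    moreover have "?A \<inter> ?B \<inter> {0..1} = {}" using v(3) le_antisym by blast
    moreover have "0 \<in> ?A \<inter> {0..1}" "1 \<in> ?B \<inter> {0..1}" using v by auto
    moreover have "connected {0..1::real}" by simp
    ultimately show False
      using closed_multiples[of u v] closed_multiples[of v u]
      unfolding connected_closed by blast
  qed
  then obtain t where t: "0 \<le> t" "t \<le> 1" "\<not> t *\<^sub>R u \<sqsubseteq> v" "\<not> v \<sqsubseteq> t *\<^sub>R u" by auto
  have tu: "t *\<^sub>R u \<in> P" using t u by (intro convex_cone_scaleR[OF cone])
  define x where "x = v - t *\<^sub>R u"
  define m where "m = meet x 0"
  have "x - v \<sqsubseteq> m"
    unfolding m_def using tu v by (intro meet_greatest) (auto simp: x_def cone_le_def)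
  then have av: "x - m \<sqsubseteq> v" by (simp add: le_diff_iff add.commute)
  have "- (t *\<^sub>R u) \<sqsubseteq> m"
    unfolding m_def using tu v by (intro meet_greatest) (auto simp: x_def cone_le_def)
  then have "- m \<sqsubseteq> t *\<^sub>R u" by (simp add: cone_le_def add.commute)
  moreover have "t *\<^sub>R u \<sqsubseteq> u"
    using convex_cone_scaleR[OF cone, of "1 - t" u] t u by (simp add: cone_le_def algebra_simps)
  ultimately have bu: "- m \<sqsubseteq> u" by (rule le_trans)
  show thesis
  proof (rule that)
    show "x - m \<in> P" using meet_le1[of x 0] by (simp add: m_def cone_le_def)
    show "- m \<in> P" using meet_le2[of x 0] by (simp add: m_def cone_le_def)
    show "x - m \<sqsubseteq> u" using av v(2) by (rule le_trans)
    show "- m \<sqsubseteq> u" by (rule bu)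
    show "meet (x - m) (- m) = 0" using meet_diff[of x m 0] by (simp add: m_def)
    show "x - m \<noteq> 0"
      using meet_le2[of x 0] t(4) by (auto simp: m_def x_def cone_le_def)
    show "- m \<noteq> 0"
      using meet_le1[of x 0] t(3) by (auto simp: m_def x_def cone_le_def)
  qed
qed

definition disjoint_sequence :: "(nat \<Rightarrow> 'a) \<Rightarrow> bool" where
  "disjoint_sequence s \<longleftrightarrow> (\<forall>n. s n \<in> P \<and> s n \<noteq> 0) \<and> (\<forall>m n. m \<noteq> n \<longrightarrow> meet (s m) (s n) = 0)"

text \<open>Split \<open>u\<close> into two disjoint pieces, keep one, split the other, and so on without end.\<close>

lemma disjoint_sequence_if_no_atom_below:
  assumes u: "u \<in> P" "u \<noteq> 0" "\<And>a. atom a \<Longrightarrow> \<not> a \<sqsubseteq> u"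
  shows "\<exists>s. disjoint_sequence s"
proof -
  \<comment> \<open>The first component is the piece kept, the second the remainder to be split next.\<close>
  define good where "good ab \<longleftrightarrow> fst ab \<in> P \<and> fst ab \<noteq> 0 \<and> snd ab \<in> P \<and> snd ab \<noteq> 0
      \<and> snd ab \<sqsubseteq> u \<and> meet (fst ab) (snd ab) = 0" for ab :: "'a \<times> 'a"
  have split: "\<exists>ab. good ab \<and> fst ab \<sqsubseteq> w \<and> snd ab \<sqsubseteq> w" if w: "w \<in> P" "w \<noteq> 0" "w \<sqsubseteq> u" for w
  proof -
    have "\<not> atom w" using u(3) w(3) by blast
    then obtain a b where "a \<in> P" "a \<noteq> 0" "a \<sqsubseteq> w" "b \<in> P" "b \<noteq> 0" "b \<sqsubseteq> w" "meet a b = 0"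
      using split_non_atom w by metis
    then have "good (a, b) \<and> fst (a, b) \<sqsubseteq> w \<and> snd (a, b) \<sqsubseteq> w"
      using w(3) by (auto simp: good_def intro: le_trans)
    then show ?thesis by blast
  qed
  have "\<exists>F. \<forall>n::nat. good (F n) \<and> (fst (F (Suc n)) \<sqsubseteq> snd (F n) \<and> snd (F (Suc n)) \<sqsubseteq> snd (F n))"
  proof (rule dependent_nat_choice)
    show "\<exists>ab. good ab" using split[of u] u by auto
    show "\<exists>cd. good cd \<and> fst cd \<sqsubseteq> snd ab \<and> snd cd \<sqsubseteq> snd ab" if "good ab" for ab and n :: nat
      using that split[of "snd ab"] by (auto simp: good_def)
  qed
  then obtain F where F: "\<And>n::nat. good (F n)" "\<And>n. fst (F (Suc n)) \<sqsubseteq> snd (F n)"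
    "\<And>n. snd (F (Suc n)) \<sqsubseteq> snd (F n)" by blast
  have dec: "snd (F (n + k)) \<sqsubseteq> snd (F n)" for n k
    by (induction k) (use F(3) le_trans in auto)
  have disj: "meet (fst (F m)) (fst (F n)) = 0" if mn: "m < n" for m n
  proof -
    obtain k where k: "n = Suc (m + k)" using less_imp_Suc_add[OF mn] by blast
    have "fst (F n) \<sqsubseteq> snd (F m)" unfolding k using F(2) dec by (rule le_trans)
    moreover have "meet (fst (F m)) (snd (F m)) = 0" "fst (F m) \<in> P" "fst (F n) \<in> P"
      using F(1) by (simp_all only: good_def)
    ultimately show ?thesis using disjoint_mono le_refl by blast
  qed
  have "meet (fst (F m)) (fst (F n)) = 0" if "m \<noteq> n" for m n
    using that disj[of m n] disj[of n m] by (cases "m < n") (auto simp: meet_commute)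
  then have "disjoint_sequence (\<lambda>n. fst (F n))"
    using F(1) by (auto simp: good_def disjoint_sequence_def)
  then show ?thesis by blast
qed

lemma largest_multiple_below:
  assumes a: "a \<in> P" "a \<noteq> 0" and x: "x \<in> P"
  obtains t where "t \<ge> 0" "t *\<^sub>R a \<sqsubseteq> x" "\<And>r. r *\<^sub>R a \<sqsubseteq> x \<Longrightarrow> r \<le> t"
proof -
  let ?T = "{t. t *\<^sub>R a \<sqsubseteq> x}"
  have "bdd_above ?T"
  proof (rule ccontr)
    assume unb: "\<not> bdd_above ?T"
    have "- a \<in> P"
    proof (rule closed_sequentially[OF closed])
      fix n :: nat
      obtain t where t: "t *\<^sub>R a \<sqsubseteq> x" "t > real (Suc n)"
        using unb unfolding bdd_above_def by (auto simp: not_le)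
      have "(t - real (Suc n)) *\<^sub>R a + (x - t *\<^sub>R a) \<in> P"
        using t a by (intro convex_cone_add[OF cone] convex_cone_scaleR[OF cone]) (auto simp: cone_le_def)
      then have "inverse (real (Suc n)) *\<^sub>R (x - real (Suc n) *\<^sub>R a) \<in> P"
        by (intro convex_cone_scaleR[OF cone]) (auto simp: algebra_simps)
      then show "inverse (real (Suc n)) *\<^sub>R x - a \<in> P" by (simp add: scaleR_diff_right)
    next
      have "(\<lambda>n. inverse (real (Suc n)) *\<^sub>R x - a) \<longlonglongrightarrow> 0 *\<^sub>R x - a"
        by (intro tendsto_intros LIMSEQ_inverse_real_of_nat)
      then show "(\<lambda>n. inverse (real (Suc n)) *\<^sub>R x - a) \<longlonglongrightarrow> - a" by simp
    qed
    then show False using pointed a by blast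
  qed
  moreover have "0 \<in> ?T" using x by simp
  ultimately have "Sup ?T \<in> ?T" "\<And>r. r \<in> ?T \<Longrightarrow> r \<le> Sup ?T"
    using closed_contains_Sup[OF _ _ closed_multiples(1)] cSup_upper[of _ ?T] by blast+
  with \<open>0 \<in> ?T\<close> show thesis by (intro that[of "Sup ?T"]) auto
qed

text \<open>If there is no such sequence, then every nonzero positive element lies above an atom, and a maximal
  pairwise disjoint set \<open>M\<close> of atoms is finite.  Subtracting from a positive \<open>x\<close> the largest multiple
  of each atom in \<open>M\<close> leaves a positive remainder; an atom below the remainder would be disjoint
  from all of \<open>M\<close>, against maximality.  So the remainder vanishes and \<open>M\<close> spans the space.\<close>

lemma disjoint_sequence_exists:
  assumes gen: "generating_cone P" and inf: "infinite_dimensional TYPE('a)"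
  shows "\<exists>s. disjoint_sequence s"
proof (rule ccontr)
  assume none: "\<not> ?thesis"
  have atoms: "\<exists>a. atom a \<and> a \<sqsubseteq> u" if "u \<in> P" "u \<noteq> 0" for u
    using disjoint_sequence_if_no_atom_below[OF that] none by blast
  define \<A> where "\<A> = {M. (\<forall>a\<in>M. atom a) \<and> pairwise (\<lambda>a b. meet a b = 0) M}"
  have "\<exists>M\<in>\<A>. \<forall>X\<in>\<A>. M \<subseteq> X \<longrightarrow> X = M"
  proof (rule subset_Zorn_nonempty)
    show "\<A> \<noteq> {}" by (auto simp: \<A>_def intro: exI[of _ "{}"])
    show "\<Union>\<C> \<in> \<A>" if "subset.chain \<A> \<C>" for \<C>
      using that pairwise_chain_Union[of \<C>] by (auto simp: \<A>_def subset_chain_def chain_subset_def)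
  qed
  then obtain M where M: "\<And>a. a \<in> M \<Longrightarrow> atom a" "pairwise (\<lambda>a b. meet a b = 0) M"
    and max: "\<And>X. X \<in> \<A> \<Longrightarrow> M \<subseteq> X \<Longrightarrow> X = M" by (auto simp: \<A>_def)
  have MP: "a \<in> P \<and> a \<noteq> 0" if "a \<in> M" for a using M(1)[OF that] by (simp add: atom_def)
  have fin: "finite M"
  proof (rule ccontr)
    assume "infinite M"
    then obtain s :: "nat \<Rightarrow> 'a" where s: "inj s" "range s \<subseteq> M"
      by (meson infinite_countable_subset)
    have "meet (s m) (s n) = 0" if "m \<noteq> n" for m n
      using M(2) s that unfolding pairwise_def inj_def by blast
    then have "disjoint_sequence s" using MP s(2) unfolding disjoint_sequence_def by blast
    then show False using none by blast
  qed
  have span: "x \<in> span M" if x: "x \<in> P" for x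
  proof -
    have "\<exists>t\<ge>0. t *\<^sub>R a \<sqsubseteq> x \<and> (\<forall>r. r *\<^sub>R a \<sqsubseteq> x \<longrightarrow> r \<le> t)" if "a \<in> M" for a
      using largest_multiple_below[of a x] MP[OF that] x by metis
    then obtain t where t: "\<And>a. a \<in> M \<Longrightarrow> t a \<ge> 0" "\<And>a. a \<in> M \<Longrightarrow> t a *\<^sub>R a \<sqsubseteq> x"
      "\<And>a r. a \<in> M \<Longrightarrow> r *\<^sub>R a \<sqsubseteq> x \<Longrightarrow> r \<le> t a" by metis
    define y where "y = x - (\<Sum>a\<in>M. t a *\<^sub>R a)"
    have "(\<Sum>a\<in>M. t a *\<^sub>R a) \<sqsubseteq> x"
      using fin M(2) t MP x by (intro disjoint_sum_le) auto
    then have yP: "y \<in> P" by (simp add: y_def cone_le_def)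
    have "y = 0"
    proof (rule ccontr)
      assume "y \<noteq> 0"
      then obtain b where b: "atom b" "b \<sqsubseteq> y" using atoms yP by blast
      have bP: "b \<in> P" "b \<noteq> 0" using b by (auto simp: atom_def)
      have disj: "meet b a = 0" if a: "a \<in> M" for a
      proof -
        have mP: "meet b a \<in> P" using bP MP[OF a] by (intro meet_in) auto
        then obtain r where r: "meet b a = r *\<^sub>R a"
          using M(1)[OF a] meet_le2[of b a] by (auto simp: atom_def)
        have "r *\<^sub>R a \<sqsubseteq> y" using meet_le1[of b a] b(2) unfolding r by (rule le_trans)
        moreover have "(\<Sum>c\<in>M - {a}. t c *\<^sub>R c) \<in> P"
          using t MP by (intro convex_cone_sum[OF cone] convex_cone_scaleR[OF cone]) auto
        then have "t a *\<^sub>R a \<sqsubseteq> (\<Sum>c\<in>M. t c *\<^sub>R c)"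
          using sum.remove[OF fin a, of "\<lambda>c. t c *\<^sub>R c"] by (simp add: cone_le_def)
        ultimately have "t a *\<^sub>R a + r *\<^sub>R a \<sqsubseteq> (\<Sum>c\<in>M. t c *\<^sub>R c) + y" by (rule le_add_mono[rotated])
        then have "(t a + r) *\<^sub>R a \<sqsubseteq> x" by (simp add: y_def scaleR_left_distrib)
        then have "r \<le> 0" using t(3)[OF a] by fastforce
        then have "- meet b a \<in> P"
          using MP[OF a] convex_cone_scaleR[OF cone, of "- r" a] by (simp add: r)
        with mP show ?thesis by (rule pointed)
      qed
      then have "insert b M \<in> \<A>"
        using M b by (auto simp: \<A>_def pairwise_insert meet_commute)
      then have "b \<in> M" using max by blast
      then show False using disj[of b] bP meet_self by simp
    qed
    then have "x = (\<Sum>a\<in>M. t a *\<^sub>R a)" by (simp add: y_def)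
    then show ?thesis by (simp add: span_sum span_scale span_base)
  qed
  have "x \<in> span M" for x
  proof -
    obtain p q where "x = p - q" "p \<in> P" "q \<in> P" using gen unfolding generating_cone_def by blast
    then show ?thesis using span by (simp add: span_diff)
  qed
  then show False using inf fin unfolding infinite_dimensional_def by blast
qed

end

section \<open>Weak compactness against an infinite disjoint sequence\<close>

lemma convex_cone_hull_range:
  fixes x :: "nat \<Rightarrow> 'a::real_vector"
  shows "convex_cone hull (range x) \<subseteq> (\<Union>m. convex_cone hull (x ` {..<m}))"
proof -
  have mono: "convex_cone hull (x ` {..<m}) \<subseteq> convex_cone hull (x ` {..<n})" if "m \<le> n" for m n
    using that by (intro hull_mono image_mono) auto
  have "range x \<subseteq> (\<Union>m. convex_cone hull (x ` {..<m}))"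
    by (auto intro!: exI[of _ "Suc _"] hull_inc)
  moreover have "convex_cone (\<Union>m. convex_cone hull (x ` {..<m}))"
  proof (rule convex_cone_iff[THEN iffD2], intro conjI ballI allI impI)
    fix u v assume "u \<in> (\<Union>m. convex_cone hull (x ` {..<m}))" "v \<in> (\<Union>m. convex_cone hull (x ` {..<m}))"
    then obtain m n where "u \<in> convex_cone hull (x ` {..<m})" "v \<in> convex_cone hull (x ` {..<n})" by blast
    then have "u \<in> convex_cone hull (x ` {..<max m n})" "v \<in> convex_cone hull (x ` {..<max m n})"
      using mono[of m "max m n"] mono[of n "max m n"] by auto
    then show "u + v \<in> (\<Union>m. convex_cone hull (x ` {..<m}))" by (blast intro: convex_cone_hull_add)
  qed (auto intro: convex_cone_hull_contains_0 convex_cone_hull_mul)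
  ultimately show ?thesis by (rule hull_minimal)
qed

lemma riesz_cone_if_lattice_cone:
  assumes "lattice_cone P"
  obtains meet where "riesz_cone P meet"
proof -
  obtain inf sup where cone: "convex_cone P"
    and lat: "class.lattice inf (cone_le P) (\<lambda>x y. cone_le P x y \<and> \<not> cone_le P y x) sup"
    using assms by (auto simp: lattice_cone_def vector_lattice_order_def)
  interpret lattice inf "cone_le P" "\<lambda>x y. cone_le P x y \<and> \<not> cone_le P y x" sup by (rule lat)
  have "riesz_cone P inf"
  proof
    fix x assume "x \<in> P" "- x \<in> P"
    then show "x = 0" using order.antisym[of x 0] by (simp add: cone_le_def)
  qed (use cone in auto)
  then show thesis by (rule that)
qed

theorem corollary7p5:
  fixes P :: "'a::banach set"
  assumes "infinite_dimensional TYPE('a)"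
    and "convex_cone P"
    and "reflexive_cone P"
    and "generating_cone P"
    and "\<exists>B. cone_base P B \<and> bounded B"
  shows "\<not> lattice_cone P"
proof
  assume "lattice_cone P"
  then obtain meet where "riesz_cone P meet" by (rule riesz_cone_if_lattice_cone)
  then interpret riesz_cone P meet .
  note gen = \<open>generating_cone P\<close>
  have cpt: "compactin weak_topology (P \<inter> cball 0 1)"
    using \<open>reflexive_cone P\<close> by (simp add: reflexive_cone_def)
  then have "closed P" by (rule closed_if_weakly_compact_part[OF cone])
  then interpret closed_riesz_cone P meet by unfold_locales
  obtain B where "cone_base P B" "bounded B" using assms(5) by blast
  then obtain f :: "'a \<Rightarrow> real" and M where f: "linear f" "M > 0" "\<And>x. x \<in> P \<Longrightarrow> norm x \<le> M * f x"
    using bounded_base_functional[OF cone gen pointed] by metis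
  have f_nonneg: "f x \<ge> 0" if "x \<in> P" for x
    using f(3)[OF that] f(2) norm_ge_zero[of x] by (meson order_trans zero_le_mult_iff not_le)
  obtain s :: "nat \<Rightarrow> 'a" where s: "\<And>n. s n \<in> P" "\<And>n. s n \<noteq> 0"
    "\<And>m n. m \<noteq> n \<Longrightarrow> meet (s m) (s n) = 0"
    using disjoint_sequence_exists[OF gen assms(1)] unfolding disjoint_sequence_def by blast
  \<comment> \<open>Rescaled so that the norm is at most \<open>1\<close> while \<open>f\<close> takes the same positive value at every term.\<close>
  define x where "x n = inverse (M * f (s n)) *\<^sub>R s n" for n
  have Mfs: "M * f (s n) > 0" for n
    using f(3)[OF s(1)[of n]] s(2)[of n] by (smt (verit) zero_less_norm_iff)
  have xP: "x n \<in> P" for n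
    unfolding x_def using s(1) Mfs
    by (intro convex_cone_scaleR[OF cone] less_imp_le positive_imp_inverse_positive)
  have fx: "f (x n) = inverse M" for n
  proof -
    have "f (s n) \<noteq> 0" using Mfs[of n] by auto
    then show ?thesis by (simp add: x_def linear_scale[OF f(1)])
  qed
  have "norm (x n) \<le> 1" for n using f(3)[OF xP] fx f(2) by (metis less_irrefl right_inverse)
  then have xK: "x n \<in> P \<inter> cball 0 1" for n using xP by simp
  have disj: "meet (x m) (x n) = 0" if "m \<noteq> n" for m n
    unfolding x_def using s(1) s(3)[OF that] Mfs
    by (metis disjoint_scale meet_commute convex_cone_scaleR[OF cone] less_imp_le positive_imp_inverse_positive)
  have hullP: "convex_cone hull (x ` N) \<subseteq> P" for N
    using xP cone by (intro hull_minimal) auto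
  have band: "\<exists>g. bounded_linear g
      \<and> (\<forall>y\<in>P. \<forall>v\<in>convex_cone hull (x ` N). f (meet y v) \<le> g y)
      \<and> (\<forall>y\<in>P. \<forall>r. (\<forall>v\<in>convex_cone hull (x ` N). f (meet y v) \<le> r) \<longrightarrow> g y \<le> r)" for N
  proof -
    obtain g where g: "linear g"
      "\<And>y v. y \<in> P \<Longrightarrow> v \<in> convex_cone hull (x ` N) \<Longrightarrow> f (meet y v) \<le> g y"
      "\<And>y r. y \<in> P \<Longrightarrow> (\<And>v. v \<in> convex_cone hull (x ` N) \<Longrightarrow> f (meet y v) \<le> r) \<Longrightarrow> g y \<le> r"
      using band_functional[OF gen f(1) f_nonneg convex_cone_convex_cone_hull hullP] by blast
    have "g y \<ge> 0" if "y \<in> P" for y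
      using g(2)[OF that convex_cone_hull_contains_0] that
        f_nonneg[OF meet_in[OF that convex_cone_contains_0[OF cone]]] by linarith
    then have "bounded_linear g" using positive_linear_bounded[OF cone closed gen g(1)] by blast
    with g show ?thesis by blast
  qed
  \<comment> \<open>\<open>\<phi> N\<close> measures the part of an element that lies in the band generated by the terms with index
    in \<open>N\<close>.  At \<open>x m\<close>, \<open>\<phi> {..<n}\<close> is at most \<open>0\<close> once \<open>n \<le> m\<close>, whereas \<open>\<phi> UNIV\<close> is at least
    \<open>inverse M\<close>; on the other hand \<open>\<phi> UNIV\<close> cannot be positive at a point where all \<open>\<phi> {..<n}\<close>
    are at most \<open>0\<close>.\<close>
  then obtain \<phi> where \<phi>: "\<And>N. bounded_linear (\<phi> N)"
    "\<And>N y v. y \<in> P \<Longrightarrow> v \<in> convex_cone hull (x ` N) \<Longrightarrow> f (meet y v) \<le> \<phi> N y"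
    "\<And>N y r. y \<in> P \<Longrightarrow> (\<And>v. v \<in> convex_cone hull (x ` N) \<Longrightarrow> f (meet y v) \<le> r) \<Longrightarrow> \<phi> N y \<le> r"
    by metis
  define U where "U n = \<phi> {..<n} -` {0<..}" for n
  define W where "W = \<phi> UNIV -` {..<inverse M}"
  have op: "openin weak_topology T" if "T \<in> insert W (range U)" for T
    using that \<phi>(1) by (auto simp: U_def W_def intro!: openin_weak_topology_vimage)
  have cov: "P \<inter> cball 0 1 \<subseteq> \<Union>(insert W (range U))"
  proof
    fix y assume "y \<in> P \<inter> cball 0 1"
    then have yP: "y \<in> P" by simp
    show "y \<in> \<Union>(insert W (range U))"
    proof (rule ccontr)
      assume "y \<notin> \<Union>(insert W (range U))"
      then have W: "\<phi> UNIV y \<ge> inverse M" and U: "\<phi> {..<n} y \<le> 0" for n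
        by (auto simp: U_def W_def not_less)
      have "f (meet y v) \<le> 0" if v: "v \<in> convex_cone hull (range x)" for v
      proof -
        obtain n where "v \<in> convex_cone hull (x ` {..<n})"
          using v convex_cone_hull_range[of x] by blast
        then show ?thesis using \<phi>(2)[OF yP] U by (meson order_trans)
      qed
      then have "\<phi> UNIV y \<le> 0" by (rule \<phi>(3)[OF yP])
      moreover have "inverse M > 0" using f(2) by simp
      ultimately show False using W by linarith
    qed
  qed
  obtain \<F> where \<F>: "finite \<F>" "\<F> \<subseteq> insert W (range U)" "P \<inter> cball 0 1 \<subseteq> \<Union>\<F>"
    using compactinD[OF cpt op cov] by blast
  then have "finite (\<F> - {W})" "\<F> - {W} \<subseteq> range U" by auto
  then obtain N where N: "finite N" "\<F> - {W} = U ` N"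
    using finite_subset_image[of "\<F> - {W}" U UNIV] by auto
  obtain m where m: "\<And>n. n \<in> N \<Longrightarrow> n \<le> m" using N(1) by (metis finite_nat_set_iff_bounded_le)
  have "x m \<notin> W"
    using \<phi>(2)[OF xP hull_inc[of "x m" "range x"], of m] fx by (simp add: W_def meet_self)
  moreover have "x m \<notin> U n" if "n \<in> N" for n
  proof -
    have "f (meet (x m) v) \<le> 0" if v: "v \<in> convex_cone hull (x ` {..<n})" for v
    proof -
      have "meet (x m) v = 0"
        using m[OF \<open>n \<in> N\<close>] xP disj by (intro disjoint_hull[OF xP _ v]) auto
      then show ?thesis by (simp add: linear_0[OF f(1)])
    qed
    then have "\<phi> {..<n} (x m) \<le> 0" by (rule \<phi>(3)[OF xP])
    then show ?thesis by (simp add: U_def)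
  qed
  ultimately show False using \<F>(3) N(2) xK[of m] by blast
qed

end
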